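(* There exists a reduced polytope in three-dimensional Euclidean space $\mathbb{R}^3$.
   Context: $\mathbb{R}^3$ carries the standard inner product $\langle\cdot,\cdot\rangle$ and the Euclidean norm $\|\cdot\|$. A polytope is the convex hull of finitely many points. A convex body is a compact convex set with non-empty interior. For a convex body $K\subseteq\mathbb{R}^3$ and $u\in\mathbb{R}^3$, let $h(K,u)=\sup\{\langle u,x\rangle : x\in K\}$ and $w(K,u)=h(K,u)+h(K,-u)$. The minimum width of $K$ is $\omega(K)=\inf\{w(K,u):\|u\|=1\}$. A convex body $K$ is called reduced if $\omega(K')<\omega(K)$ for every convex body $K'\subsetneq K$. A reduced polytope is a polytope which is a convex body (i.e. has non-empty interior) and is reduced. *)

theory Defs
  imports "HOL-Analysis.Analysis"
begin

definition convex_body :: "'a::euclidean_space set \<Rightarrow> bool" where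
  "convex_body K \<longleftrightarrow> compact K \<and> convex K \<and> interior K \<noteq> {}"

definition support_fun :: "'a::euclidean_space set \<Rightarrow> 'a \<Rightarrow> real" where
  "support_fun K u = (SUP x\<in>K. u \<bullet> x)"

definition width_along :: "'a::euclidean_space set \<Rightarrow> 'a \<Rightarrow> real" where
  "width_along K u = support_fun K u + support_fun K (- u)"

definition min_width :: "'a::euclidean_space set \<Rightarrow> real" where
  "min_width K = Inf {width_along K u | u. norm u = 1}"

definition reduced_body :: "'a::euclidean_space set \<Rightarrow> bool" where
  "reduced_body K \<longleftrightarrow>
     convex_body K \<and> (\<forall>K'. convex_body K' \<and> K' \<subset> K \<longrightarrow> min_width K' < min_width K)"

definition reduced_polytope :: "'a::euclidean_space set \<Rightarrow> bool" where
  "reduced_polytope P \<longleftrightarrow> polytope P \<and> reduced_body P"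

end

theory Submission
  imports Defs
begin

text \<open>
  A polytope is reduced as soon as every vertex \<open>v\<close> is the unique maximiser over it of some
  direction in which the minimum width is attained: a proper convex sub-body misses some vertex
  and is therefore strictly narrower in the direction belonging to that vertex.

  The example has twelve vertices in two orbits of size four and eight under the group generated by
  the reflections in the first two coordinates and \<open>(x, y, z) \<mapsto> (y, x, -z)\<close>. Prescribing the normals
  \<open>(52, 0, -47)\<close> and \<open>(2, 3, 2)\<close>, of squared lengths \<open>17\<^sup>3\<close> and \<open>17\<close>, for the facets
  opposite to one vertex of each orbit, and requiring equal widths in these two directions, is a
  linear system for the coordinates, which is why they can be taken to be integers. The minimum
  width is \<open>9236 / sqrt 17\<close>. That no direction is narrower is checked on a fundamental domain of
  the symmetry group of the difference body. The domain is covered by eight simplicial cones, and on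
  each of them a single difference \<open>z\<close> of vertices suffices, because \<open>{u. W * norm u \<le> z \<bullet> u}\<close> is
  a convex cone and contains the three generators.
\<close>

section \<open>Reducedness of the hull of a finite set\<close>

lemma bdd_above_inner_compact:
  fixes K :: "'a::euclidean_space set"
  assumes "compact K"
  shows "bdd_above ((\<lambda>x. u \<bullet> x) ` K)"
proof -
  have "compact ((\<lambda>x. u \<bullet> x) ` K)"
    by (intro compact_continuous_image continuous_intros assms)
  then show ?thesis
    by (intro bounded_imp_bdd_above compact_imp_bounded)
qed

lemma inner_le_support_fun:
  assumes "compact K" "x \<in> K"
  shows "u \<bullet> x \<le> support_fun K u"
  unfolding support_fun_def
  using assms by (intro cSUP_upper bdd_above_inner_compact)

lemma min_width_le:
  assumes "compact K" "K \<noteq> {}" "norm u = 1"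
  shows "min_width K \<le> width_along K u"
proof -
  obtain x where x: "x \<in> K" using assms by blast
  have "0 \<le> width_along K v" for v
    using inner_le_support_fun[OF assms(1) x, of v] inner_le_support_fun[OF assms(1) x, of "- v"]
    by (simp add: width_along_def)
  then have "bdd_below {width_along K u | u. norm u = 1}"
    by (intro bdd_belowI[of _ 0]) auto
  then show ?thesis
    unfolding min_width_def using assms(3) by (intro cInf_lower) auto
qed

text \<open>A hull point \<open>x \<noteq> v\<close> mixes \<open>v\<close> with some
  \<open>y\<close> in the hull of the other points, with positive weight on \<open>y\<close>; the
  open half-space below \<open>n \<bullet> v\<close> is convex and contains those points, hence
  \<open>y\<close>.\<close>

lemma inner_less_on_convex_hull:
  fixes V :: "'a::euclidean_space set"
  assumes strict: "\<And>w. w \<in> V \<Longrightarrow> w \<noteq> v \<Longrightarrow> n \<bullet> w < n \<bullet> v"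
    and v: "v \<in> V" and x: "x \<in> convex hull V" "x \<noteq> v"
  shows "n \<bullet> x < n \<bullet> v"
proof -
  have V: "V = insert v (V - {v})" using v by blast
  have ne: "V - {v} \<noteq> {}"
  proof
    assume "V - {v} = {}"
    with V have "V = {v}" by simp
    with x show False by simp
  qed
  obtain a b y where ab: "0 \<le> a" "0 \<le> b" "a + b = 1" and y: "y \<in> convex hull (V - {v})"
    and xeq: "x = a *\<^sub>R v + b *\<^sub>R y"
    using x(1) convex_hull_insert[OF ne, of v] V by auto
  have "convex hull (V - {v}) \<subseteq> {y. n \<bullet> y < n \<bullet> v}"
    by (rule hull_minimal) (use strict in \<open>auto simp: convex_halfspace_lt\<close>)
  with y have "n \<bullet> y < n \<bullet> v" by blast
  moreover have "b \<noteq> 0" using ab xeq x(2) by auto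
  ultimately have "b * (n \<bullet> y) < b * (n \<bullet> v)" using ab by simp
  moreover have "n \<bullet> v = a * (n \<bullet> v) + b * (n \<bullet> v)"
    using ab by (simp flip: distrib_right)
  ultimately show ?thesis by (simp add: xeq inner_right_distrib)
qed

text \<open>Hypothesis \<open>wide\<close> bounds all widths from below by \<open>W\<close>; the
  last clause of \<open>tight\<close> bounds the width along \<open>n\<close> from above. Both are
  homogeneous in the direction, so integer normals can be used as they are.\<close>

theorem reduced_polytope_convex_hull:
  fixes V :: "'a::euclidean_space set"
  assumes fin: "finite V" and W: "0 < W"
    and wide: "\<And>u. \<exists>v\<in>V. \<exists>w\<in>V. W * norm u \<le> u \<bullet> (v - w)"
    and tight: "\<And>v. v \<in> V \<Longrightarrow> \<exists>n. n \<noteq> 0 \<and> (\<forall>w\<in>V. w \<noteq> v \<longrightarrow> n \<bullet> w < n \<bullet> v)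
                  \<and> (\<forall>w\<in>V. n \<bullet> (v - w) \<le> W * norm n)"
  shows "reduced_polytope (convex hull V)"
proof -
  let ?P = "convex hull V"
  have P: "compact ?P" using fin by (rule finite_imp_compact_convex_hull)
  have inP: "v \<in> ?P" if "v \<in> V" for v using that by (rule hull_inc)
  \<comment> \<open>A hull inside a hyperplane would have width 0 along its normal, against
    \<open>wide\<close>.\<close>
  have "interior ?P \<noteq> {}"
  proof
    assume "interior ?P = {}"
    then obtain a b where "a \<noteq> 0" and "?P \<subseteq> {x. a \<bullet> x = b}"
      using empty_interior_subset_hyperplane[OF convex_convex_hull] by metis
    then have "a \<bullet> (v - w) = 0" if "v \<in> V" "w \<in> V" for v w
      using inP that by (auto simp: inner_diff_right)
    then have "W * norm a \<le> 0" using wide[of a] by auto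
    with W \<open>a \<noteq> 0\<close> show False by (simp add: mult_le_0_iff)
  qed
  with P have body: "convex_body ?P" by (simp add: convex_body_def)
  have "W \<le> width_along ?P u" if u: "norm u = 1" for u
  proof -
    obtain v w where vw: "v \<in> V" "w \<in> V" "W * norm u \<le> u \<bullet> (v - w)" using wide by blast
    show ?thesis
      using vw(3) u inner_le_support_fun[OF P inP[OF vw(1)], of u]
        inner_le_support_fun[OF P inP[OF vw(2)], of "- u"]
      by (simp add: width_along_def inner_diff_right)
  qed
  moreover have "\<exists>u::'a. norm u = 1" by (metis vector_choose_size zero_le_one)
  ultimately have W_le: "W \<le> min_width ?P"
    unfolding min_width_def by (intro cInf_greatest) auto
  have "min_width K < min_width ?P" if K: "convex_body K" "K \<subset> ?P" for K
  proof -
    have cK: "compact K" "convex K" "K \<noteq> {}" using K by (auto simp: convex_body_def)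
    obtain v where v: "v \<in> V" "v \<notin> K"
      using hull_minimal[of V K convex] cK(2) K(2) by blast
    obtain n where n: "n \<noteq> 0" "\<And>w. w \<in> V \<Longrightarrow> w \<noteq> v \<Longrightarrow> n \<bullet> w < n \<bullet> v"
      "\<And>w. w \<in> V \<Longrightarrow> n \<bullet> (v - w) \<le> W * norm n"
      using tight[OF v(1)] by blast
    define u where "u = n /\<^sub>R norm n"
    have u: "norm u = 1" using n(1) by (simp add: u_def)
    have strict: "u \<bullet> w < u \<bullet> v" if "w \<in> V" "w \<noteq> v" for w
      using n(1) n(2)[OF that] by (simp add: u_def)
    have width: "- u \<bullet> w \<le> W - u \<bullet> v" if "w \<in> V" for w
    proof -
      have "u \<bullet> (v - w) \<le> W"
        using n(1) n(3)[OF that] by (simp add: u_def field_simps)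
      then show ?thesis by (simp add: inner_diff_right)
    qed
    \<comment> \<open>The maximum over \<open>K\<close> is attained, so strictness at each point of
      \<open>K\<close> passes to the support function.\<close>
    obtain x where x: "x \<in> K" "\<And>y. y \<in> K \<Longrightarrow> u \<bullet> y \<le> u \<bullet> x"
      using continuous_attains_sup[OF cK(1) cK(3) continuous_on_inner[OF continuous_on_const continuous_on_id]]
      by blast
    have "support_fun K u \<le> u \<bullet> x"
      unfolding support_fun_def using cK(3) x(2) by (rule cSUP_least)
    also have "u \<bullet> x < u \<bullet> v"
      using inner_less_on_convex_hull[OF strict v(1)] x(1) v(2) K(2) by blast
    finally have 1: "support_fun K u < u \<bullet> v" .
    have "?P \<subseteq> {y. - u \<bullet> y \<le> W - u \<bullet> v}"
      by (rule hull_minimal) (use width convex_halfspace_le[of "- u"] in auto)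
    then have 2: "support_fun K (- u) \<le> W - u \<bullet> v"
      unfolding support_fun_def using K(2) by (intro cSUP_least cK(3)) auto
    have "min_width K \<le> width_along K u" using cK(1,3) u by (rule min_width_le)
    also have "\<dots> < W" using 1 2 by (simp add: width_along_def)
    finally show ?thesis using W_le by simp
  qed
  with body show ?thesis
    using fin by (auto simp: reduced_polytope_def reduced_body_def polytope_def)
qed

section \<open>The twelve vertices\<close>

definition pt :: "real \<Rightarrow> real \<Rightarrow> real \<Rightarrow> real ^ 3" where
  "pt a b c = vector [a, b, c]"

lemma inner_pt: "pt a b c \<bullet> pt a' b' c' = a * a' + b * b' + c * c'"
  by (simp add: pt_def inner_vec_def sum_3)

lemma pt_eq_iff: "pt a b c = pt a' b' c' \<longleftrightarrow> a = a' \<and> b = b' \<and> c = c'"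
  by (auto simp: pt_def vec_eq_iff forall_3)

lemma pt_add: "pt a b c + pt a' b' c' = pt (a + a') (b + b') (c + c')"
  and pt_diff: "pt a b c - pt a' b' c' = pt (a - a') (b - b') (c - c')"
  and pt_scaleR: "r *\<^sub>R pt a b c = pt (r * a) (r * b) (r * c)"
  by (simp_all add: pt_def vec_eq_iff forall_3)

lemma norm_pt: "norm (pt a b c) = sqrt (a * a + b * b + c * c)"
  by (simp add: norm_eq_sqrt_inner inner_pt)

lemma pt_cases: obtains a b c where "u = pt a b c"
proof
  show "u = pt (u $ 1) (u $ 2) (u $ 3)"
    by (simp add: pt_def vec_eq_iff forall_3)
qed

definition vertices :: "(real ^ 3) set" where
  "vertices =
    {pt 749 0 (-1256), pt (-749) 0 (-1256), pt 0 749 1256, pt 0 (-749) 1256,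
     pt 194 1410 304, pt 194 (-1410) 304, pt (-194) 1410 304, pt (-194) (-1410) 304,
     pt 1410 194 (-304), pt 1410 (-194) (-304), pt (-1410) 194 (-304), pt (-1410) (-194) (-304)}"

definition width :: real where
  "width = 9236 / sqrt 17"

text \<open>The differences \<open>v - w\<close> generate the difference body, whose support
  function is the width of the polytope.\<close>

definition wide :: "real ^ 3 \<Rightarrow> bool" where
  "wide u \<longleftrightarrow> (\<exists>v\<in>vertices. \<exists>w\<in>vertices. width * norm u \<le> u \<bullet> (v - w))"

section \<open>Symmetries of the difference body\<close>

lemma wide_reflect:
  assumes "wide (pt a b c)"
  shows wide_reflect_1: "wide (pt (- a) b c)"
    and wide_reflect_2: "wide (pt a (- b) c)"
    and wide_rotoreflect: "wide (pt b a (- c))"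
    and wide_uminus: "wide (pt (- a) (- b) (- c))"
proof -
  obtain v1 v2 v3 w1 w2 w3 where
    v: "pt v1 v2 v3 \<in> vertices" and w: "pt w1 w2 w3 \<in> vertices"
    and le: "width * norm (pt a b c) \<le> pt a b c \<bullet> (pt v1 v2 v3 - pt w1 w2 w3)"
    using assms unfolding wide_def by (metis pt_cases)
  note le = le[unfolded pt_diff inner_pt norm_pt]
  have sym: "pt (- x) y z \<in> vertices" "pt x (- y) z \<in> vertices" "pt y x (- z) \<in> vertices"
    if "pt x y z \<in> vertices" for x y z
    using that unfolding vertices_def insert_iff empty_iff pt_eq_iff
    by (elim disjE conjE; simp)+
  show "wide (pt (- a) b c)"
    unfolding wide_def
    by (intro bexI[OF _ sym(1)[OF v]] bexI[OF _ sym(1)[OF w]])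
      (use le in \<open>simp add: pt_diff inner_pt norm_pt algebra_simps\<close>)
  show "wide (pt a (- b) c)"
    unfolding wide_def
    by (intro bexI[OF _ sym(2)[OF v]] bexI[OF _ sym(2)[OF w]])
      (use le in \<open>simp add: pt_diff inner_pt norm_pt algebra_simps\<close>)
  show "wide (pt b a (- c))"
    unfolding wide_def
    by (intro bexI[OF _ sym(3)[OF v]] bexI[OF _ sym(3)[OF w]])
      (use le in \<open>simp add: pt_diff inner_pt norm_pt algebra_simps\<close>)
  \<comment> \<open>The central symmetry does not preserve \<open>vertices\<close>; it comes from
    exchanging \<open>v\<close> and \<open>w\<close>.\<close>
  show "wide (pt (- a) (- b) (- c))"
    unfolding wide_def
    by (intro bexI[OF _ w] bexI[OF _ v])
      (use le in \<open>simp add: pt_diff inner_pt norm_pt algebra_simps\<close>)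
qed

text \<open>With this, all sign changes and the plain swap of the first two coordinates are
  available, which leaves the domain \<open>0 \<le> b \<le> a\<close>,
  \<open>0 \<le> c\<close>.\<close>

lemma wide_reflect_3:
  assumes "wide (pt a b c)"
  shows "wide (pt a b (- c))"
  using wide_reflect_1[OF wide_reflect_2[OF wide_uminus[OF assms]]] by simp

lemma wide_swap:
  assumes "wide (pt a b c)"
  shows "wide (pt b a c)"
  using wide_reflect_3[OF wide_rotoreflect[OF assms]] by simp

lemma wide_abs:
  assumes "wide (pt \<bar>a\<bar> \<bar>b\<bar> \<bar>c\<bar>)"
  shows "wide (pt a b c)"
proof -
  have "wide (pt a \<bar>b\<bar> \<bar>c\<bar>)" using assms wide_reflect_1[OF assms] by (auto simp: abs_if split: if_splits)
  then have "wide (pt a b \<bar>c\<bar>)" using wide_reflect_2[of a "\<bar>b\<bar>" "\<bar>c\<bar>"] by (auto simp: abs_if split: if_splits)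
  then show ?thesis using wide_reflect_3[of a b "\<bar>c\<bar>"] by (auto simp: abs_if split: if_splits)
qed

section \<open>Width bounds on simplicial cones\<close>

lemma width_pos: "0 < width"
  by (simp add: width_def)

text \<open>Squaring removes \<open>sqrt 17\<close> and the norm, leaving integer arithmetic for
  integer \<open>z\<close> and \<open>g\<close>.\<close>

lemma width_norm_le:
  assumes "0 \<le> z \<bullet> g" "9236\<^sup>2 * (g \<bullet> g) \<le> 17 * (z \<bullet> g)\<^sup>2"
  shows "width * norm g \<le> z \<bullet> g"
proof (rule power2_le_imp_le)
  have "(width * norm g)\<^sup>2 = 9236\<^sup>2 * (g \<bullet> g) / 17"
    by (simp add: width_def power_mult_distrib power_divide power2_norm_eq_inner)
  then show "(width * norm g)\<^sup>2 \<le> (z \<bullet> g)\<^sup>2" using assms(2) by simp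
qed (fact assms(1))

lemma norm_le_inner_cone:
  fixes z :: "'a::real_inner"
  assumes "0 \<le> W"
    and "W * norm g1 \<le> z \<bullet> g1" "W * norm g2 \<le> z \<bullet> g2" "W * norm g3 \<le> z \<bullet> g3"
    and "0 \<le> l1" "0 \<le> l2" "0 \<le> l3"
    and u: "u = l1 *\<^sub>R g1 + l2 *\<^sub>R g2 + l3 *\<^sub>R g3"
  shows "W * norm u \<le> z \<bullet> u"
proof -
  have "norm u \<le> norm (l1 *\<^sub>R g1) + norm (l2 *\<^sub>R g2) + norm (l3 *\<^sub>R g3)"
    unfolding u by (rule norm_triangle_le add_mono norm_triangle_ineq order_refl)+
  then have "norm u \<le> l1 * norm g1 + l2 * norm g2 + l3 * norm g3"
    using assms(5-7) by simp
  then have "W * norm u \<le> W * (l1 * norm g1 + l2 * norm g2 + l3 * norm g3)"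
    using assms(1) by (rule mult_left_mono)
  also have "\<dots> = l1 * (W * norm g1) + l2 * (W * norm g2) + l3 * (W * norm g3)"
    by (simp add: algebra_simps)
  also have "\<dots> \<le> l1 * (z \<bullet> g1) + l2 * (z \<bullet> g2) + l3 * (z \<bullet> g3)"
    using assms by (intro add_mono mult_left_mono)
  also have "\<dots> = z \<bullet> u" by (simp add: u inner_add_right)
  finally show ?thesis .
qed

lemma wide_cone:
  assumes "v \<in> vertices" "w \<in> vertices"
    and g: "\<forall>g\<in>{g1, g2, g3}. 0 \<le> (v - w) \<bullet> g \<and> 9236\<^sup>2 * (g \<bullet> g) \<le> 17 * ((v - w) \<bullet> g)\<^sup>2"
    and l: "0 \<le> l1" "0 \<le> l2" "0 \<le> l3" "u = l1 *\<^sub>R g1 + l2 *\<^sub>R g2 + l3 *\<^sub>R g3"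
  shows "wide u"
proof -
  have "width * norm u \<le> (v - w) \<bullet> u"
    by (rule norm_le_inner_cone[OF _ _ _ _ l]) (use g in \<open>auto intro: width_norm_le simp: width_pos less_imp_le\<close>)
  then show ?thesis
    using assms(1,2) by (auto simp: wide_def inner_commute)
qed

lemma wide_fundamental_domain:
  assumes "0 \<le> b" "b \<le> a" "0 \<le> c"
  shows "wide (pt a b c)"
proof -
  \<comment> \<open>Only \<open>(3, 2, 2)\<close> and \<open>(52, 0, 47)\<close> are forced, being normals of the facets of the
    difference body at minimal distance; the other generators have slack, and small ones were taken.\<close>
  note simps = vertices_def pt_eq_iff pt_diff pt_add pt_scaleR inner_pt
  \<comment> \<open>In each case the last three terms are the coordinates of \<open>pt a b c\<close>
    in the generators; the case hypotheses state nonnegativity of those whose sign the domain does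
    not already give.\<close>
  have 1: "wide (pt a b c)" if "0 \<le> 2*a - 2*b - c" "0 \<le> b - c"
    by (rule wide_cone[of "pt 1410 194 (-304)" "pt (-1410) (-194) (-304)"
          "pt 1 0 0" "pt 1 1 0" "pt 3 2 2" "(2*a - 2*b - c) / 2" "b - c" "c / 2"])
      (use assms that in \<open>auto simp: simps field_simps\<close>)
  have 2: "wide (pt a b c)" if "0 \<le> 8*a - 3*b - 9*c" "0 \<le> 7*b - 3*c" "0 \<le> c - b"
    by (rule wide_cone[of "pt 1410 194 (-304)" "pt (-1410) (-194) (-304)"
          "pt 1 0 0" "pt 3 2 2" "pt 9 3 7"
          "(8*a - 3*b - 9*c) / 8" "(7*b - 3*c) / 8" "(c - b) / 4"])
      (use assms that in \<open>auto simp: simps field_simps\<close>)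
  have 3: "wide (pt a b c)" if "0 \<le> 3*a + 5*b - 6*c" "0 \<le> 3*c - 7*b"
    by (rule wide_cone[of "pt 1410 194 (-304)" "pt (-1410) (-194) (-304)"
          "pt 1 0 0" "pt 9 3 7" "pt 2 0 1"
          "(3*a + 5*b - 6*c) / 3" "b / 3" "(3*c - 7*b) / 3"])
      (use assms that in \<open>auto simp: simps field_simps\<close>)
  have 4: "wide (pt a b c)" if "0 \<le> 60*c - 43*a - 11*b" "0 \<le> 3*b - a"
    by (rule wide_cone[of "pt 0 749 1256" "pt (-749) 0 (-1256)"
          "pt 0 0 1" "pt 10 10 9" "pt 9 3 7"
          "(60*c - 43*a - 11*b) / 60" "(3*b - a) / 20" "(a - b) / 6"])
      (use assms that in \<open>auto simp: simps field_simps\<close>)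
  have 5: "wide (pt a b c)" if "0 \<le> 156*c - 141*a + 59*b" "0 \<le> a - 3*b"
    by (rule wide_cone[of "pt 0 749 1256" "pt (-749) 0 (-1256)"
          "pt 0 0 1" "pt 9 3 7" "pt 52 0 47"
          "(156*c - 141*a + 59*b) / 156" "b / 3" "(a - 3*b) / 52"])
      (use assms that in \<open>auto simp: simps field_simps\<close>)
  have 6: "wide (pt a b c)" if "0 \<le> 6*c - 3*a - 5*b" "0 \<le> 141*a - 59*b - 156*c"
    by (rule wide_cone[of "pt 1410 194 (-304)" "pt (-749) 0 (-1256)"
          "pt 52 0 47" "pt 2 0 1" "pt 9 3 7"
          "(6*c - 3*a - 5*b) / 126" "(141*a - 59*b - 156*c) / 126" "b / 3"])
      (use assms that in \<open>auto simp: simps field_simps\<close>)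
  have 7: "wide (pt a b c)"
    if "0 \<le> 9*c - 8*a + 3*b" "0 \<le> 10*c - 2*a - 7*b" "0 \<le> 43*a + 11*b - 60*c"
    by (rule wide_cone[of "pt 0 749 1256" "pt (-1410) (-194) (-304)"
          "pt 10 10 9" "pt 9 3 7" "pt 3 2 2"
          "(9*c - 8*a + 3*b) / 31" "(10*c - 2*a - 7*b) / 31" "(43*a + 11*b - 60*c) / 31"])
      (use assms that in \<open>auto simp: simps field_simps\<close>)
  have 8: "wide (pt a b c)" if "0 \<le> 2*a + 7*b - 10*c" "0 \<le> c - 2*a + 2*b"
    by (rule wide_cone[of "pt 194 1410 304" "pt (-1410) (-194) (-304)"
          "pt 1 1 0" "pt 3 2 2" "pt 10 10 9"
          "(2*a + 7*b - 10*c) / 9" "a - b" "(c - 2*a + 2*b) / 9"])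
      (use assms that in \<open>auto simp: simps field_simps\<close>)
  \<comment> \<open>The cones triangulate the domain: besides its three extreme rays,
    \<open>pt 2 0 1\<close> and \<open>pt 52 0 47\<close> lie on the face \<open>b = 0\<close>,
    \<open>pt 10 10 9\<close> on \<open>a = b\<close>, and \<open>pt 3 2 2\<close> and
    \<open>pt 9 3 7\<close> inside.\<close>
  show ?thesis
    using 1 2 3 4 5 6 7 8 assms by argo
qed

lemma wide_all: "wide u"
proof (cases u rule: pt_cases)
  case (1 a b c)
  have "wide (pt \<bar>a\<bar> \<bar>b\<bar> \<bar>c\<bar>)"
  proof (cases "\<bar>b\<bar> \<le> \<bar>a\<bar>")
    case True
    then show ?thesis by (intro wide_fundamental_domain) auto
  next
    case False
    then show ?thesis by (intro wide_swap[OF wide_fundamental_domain]) auto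
  qed
  then show ?thesis unfolding 1 by (rule wide_abs)
qed

section \<open>Tight directions at the vertices\<close>

lemma vertices_tight:
  assumes "v \<in> vertices"
  shows "\<exists>n. n \<noteq> 0 \<and> (\<forall>w\<in>vertices. w \<noteq> v \<longrightarrow> n \<bullet> w < n \<bullet> v)
           \<and> (\<forall>w\<in>vertices. n \<bullet> (v - w) \<le> width * norm n)"
proof -
  \<comment> \<open>A squared length \<open>17 * k\<^sup>2\<close> cancels the root in
    \<open>width\<close>, so only integer comparisons remain.\<close>
  have *: ?thesis
    if "n \<bullet> n = 17 * k\<^sup>2" "0 < k" "\<forall>w\<in>vertices. w = v \<or> n \<bullet> w < n \<bullet> v"
      "\<forall>w\<in>vertices. n \<bullet> (v - w) \<le> 9236 * k" for n and k :: real
  proof -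
    have "norm n = sqrt 17 * k"
      using that(1,2) by (simp add: norm_eq_sqrt_inner real_sqrt_mult)
    then have "width * norm n = 9236 * k" by (simp add: width_def)
    moreover have "n \<noteq> 0" using that(1,2) by auto
    ultimately show ?thesis using that(3,4) by auto
  qed
  note simps = inner_pt pt_diff pt_eq_iff
  \<comment> \<open>The normals are the images of the two prescribed ones under the symmetry group,
    so their first two coordinates copy the signs of the vertex through \<open>sgn\<close>.\<close>
  from assms consider
      x where "x = 749 \<or> x = -749" "v = pt x 0 (-1256)"
    | y where "y = 749 \<or> y = -749" "v = pt 0 y 1256"
    | x y where "x = 194 \<or> x = -194" "y = 1410 \<or> y = -1410" "v = pt x y 304"
    | x y where "x = 1410 \<or> x = -1410" "y = 194 \<or> y = -194" "v = pt x y (-304)"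
    unfolding vertices_def insert_iff empty_iff by (elim disjE FalseE) blast+
  then show ?thesis
  proof cases
    case (1 x)
    then show ?thesis
      by (elim disjE; intro *[of "pt (52 * sgn x) 0 (-47)" 17]) (simp_all add: vertices_def simps)
  next
    case (2 y)
    then show ?thesis
      by (elim disjE; intro *[of "pt 0 (52 * sgn y) 47" 17]) (simp_all add: vertices_def simps)
  next
    case (3 x y)
    then show ?thesis
      by (elim disjE; intro *[of "pt (2 * sgn x) (3 * sgn y) 2" 1]) (simp_all add: vertices_def simps)
  next
    case (4 x y)
    then show ?thesis
      by (elim disjE; intro *[of "pt (3 * sgn x) (2 * sgn y) (-2)" 1])
        (simp_all add: vertices_def simps)
  qed
qed

theorem mainTheorem1:
  shows "\<exists>P :: (real ^ 3) set. reduced_polytope P"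
proof
  show "reduced_polytope (convex hull vertices)"
  proof (rule reduced_polytope_convex_hull)
    show "finite vertices" by (simp add: vertices_def)
    show "0 < width" by (rule width_pos)
    show "\<exists>v\<in>vertices. \<exists>w\<in>vertices. width * norm u \<le> u \<bullet> (v - w)" for u
      using wide_all[of u] by (simp add: wide_def)
  qed (fact vertices_tight)
qed

end
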